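(* Fix $t>0$, $x_0\in\mathbb{R}$ and $\sigma>0$. For $\mu\in\mathbb{R}$ let $\gamma_{\mu}$ denote the Gaussian probability measure on $\mathbb{R}$ with mean $x_0+\mu t$ and variance $\sigma^2 t$. For $n\in\mathbb{N}$ let $T^*_n:\mathbb{R}^n\to\mathbb{R}$ be given by $$T^*_n((z_k)_{1\le k\le n})=\frac{\sum_{k=1}^n (z_k-x_0)}{nt}.$$ Then the estimators $T_*^{(0)}:\mathbb{R}^\infty\to\mathbb{R}$ and $T_*^{(1)}:\mathbb{R}^\infty\to\mathbb{R}$ defined by $$T_*^{(0)}((z_k)_{k\in\mathbb{N}})=\liminf_{n\to\infty}T^*_n((z_k)_{1\le k\le n})$$ and $$T_*^{(1)}((z_k)_{k\in\mathbb{N}})=\limsup_{n\to\infty}T^*_n((z_k)_{1\le k\le n})$$ are infinite-sample consistent estimators of the drift parameter $\mu$ for the family of probability measures $(\gamma_{\mu}^{\infty})_{\mu\in\mathbb{R}}$.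
   Context: $\mathbb{N}=\{1,2,\dots\}$, and $\mathbb{R}^{\infty}=\mathbb{R}^{\mathbb{N}}$ is the space of real sequences with its Borel $\sigma$-algebra. For a Borel probability measure $\gamma$ on $\mathbb{R}$, $\gamma^{\infty}$ is the infinite product (power) measure on $\mathbb{R}^{\infty}$. The measure $\gamma_{\mu}$ is the law at time $t$ of the Wiener process with drift $X_t=x_0+\mu t+\sigma W_t$. Given a family $(\gamma_\theta)_{\theta\in\mathbb{R}}$ of Borel probability measures on $\mathbb{R}$, a Borel measurable function $T:\mathbb{R}^\infty\to\mathbb{R}$ is called an infinite-sample consistent estimator of the parameter $\theta$ for the family $(\gamma_\theta^\infty)_{\theta\in\mathbb{R}}$ if $\gamma_\theta^\infty(\{(x_k)_{k\in\mathbb{N}}\in\mathbb{R}^\infty:T((x_k)_{k\in\mathbb{N}})=\theta\})=1$ for every $\theta\in\mathbb{R}$. *)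

theory Defs
  imports "HOL-Probability.Probability"
begin

text \<open>
  The space of real sequences is \<^typ>\<open>nat \<Rightarrow> real\<close> with its product topology, and
  \<^term>\<open>borel\<close> is its Borel sigma-algebra, which coincides with the product
  sigma-algebra (\<open>sets_PiM_equal_borel\<close>). The sample points \<open>z\<^sub>1, z\<^sub>2, \<dots>\<close> are indexed from
  \<open>0\<close>: the sequence entry \<open>z k\<close> stands for \<open>z\<^sub>k\<^sub>+\<^sub>1\<close>.
\<close>

definition infinite_power :: "real measure \<Rightarrow> (nat \<Rightarrow> real) measure" where
  "infinite_power M = (\<Pi>\<^sub>M k\<in>UNIV. M)"

definition infinite_sample_consistent ::
  "(real \<Rightarrow> real measure) \<Rightarrow> ((nat \<Rightarrow> real) \<Rightarrow> real) \<Rightarrow> bool" where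
  "infinite_sample_consistent \<gamma> T \<longleftrightarrow>
     (\<forall>\<theta>. prob_space (\<gamma> \<theta>) \<and> sets (\<gamma> \<theta>) = sets borel) \<and>
     T \<in> borel_measurable borel \<and>
     (\<forall>\<theta>. emeasure (infinite_power (\<gamma> \<theta>)) {z. T z = \<theta>} = 1)"

text \<open>The second argument of \<^const>\<open>normal_density\<close> is the standard deviation.\<close>

definition drift_gaussian :: "real \<Rightarrow> real \<Rightarrow> real \<Rightarrow> real \<Rightarrow> real measure" where
  "drift_gaussian t x0 \<sigma> \<mu> = density lborel (normal_density (x0 + \<mu> * t) (sqrt (\<sigma>\<^sup>2 * t)))"

text \<open>
  This only reads the first \<open>n\<close> entries of \<open>z\<close>, so it represents a function on the
  \<open>n\<close>-dimensional sample space. The value at \<open>n = 0\<close> is irrelevant for limits.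
\<close>

definition drift_estimator :: "real \<Rightarrow> real \<Rightarrow> nat \<Rightarrow> (nat \<Rightarrow> real) \<Rightarrow> real" where
  "drift_estimator t x0 n z = (\<Sum>k<n. (z k - x0)) / (real n * t)"

text \<open>
  The lower and upper limits of a real sequence are extended reals. To obtain real-valued
  estimators, the values \<open>-\<infinity>\<close> and \<open>\<infinity>\<close> are replaced by real numbers \<open>lo\<close> and \<open>hi\<close>; these
  remain parameters, so that no particular convention for infinite limits is imposed.
\<close>

definition real_value :: "real \<Rightarrow> real \<Rightarrow> ereal \<Rightarrow> real" where
  "real_value lo hi e =
     (if e = \<infinity> then hi else if e = -\<infinity> then lo else real_of_ereal e)"

definition liminf_estimator ::
  "real \<Rightarrow> real \<Rightarrow> real \<Rightarrow> real \<Rightarrow> (nat \<Rightarrow> real) \<Rightarrow> real" where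
  "liminf_estimator lo hi t x0 z =
     real_value lo hi (liminf (\<lambda>n. ereal (drift_estimator t x0 n z)))"

definition limsup_estimator ::
  "real \<Rightarrow> real \<Rightarrow> real \<Rightarrow> real \<Rightarrow> (nat \<Rightarrow> real) \<Rightarrow> real" where
  "limsup_estimator lo hi t x0 z =
     real_value lo hi (limsup (\<lambda>n. ereal (drift_estimator t x0 n z)))"

end

theory Submission imports Defs begin

text \<open>
  Consistency is the strong law of large numbers for Gaussian samples. A sum of \<open>n\<close> independent
  Gaussians is again Gaussian, so its centred fourth moment is \<open>3 n\<^sup>2 \<sigma>\<^sup>4\<close>. Hence the fourth powers
  of the errors of the sample means have a convergent series of expectations; almost surely the
  series itself is finite, and its terms tend to \<open>0\<close>.
\<close>

text \<open>The constant comes from the even-moment formula with exponent 2 * 2: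
  \<open>fact 4 / (2 ^ 2 * fact 2) = 3\<close>.\<close>

lemma nn_integral_normal_fourth_moment:
  assumes X: "distributed M lborel X (normal_density \<mu> \<sigma>)" and \<sigma>: "0 < \<sigma>"
  shows "(\<integral>\<^sup>+\<omega>. ennreal ((X \<omega> - \<mu>) ^ 4) \<partial>M) = ennreal (3 * \<sigma> ^ 4)"
proof -
  have m: "has_bochner_integral lborel (\<lambda>x. normal_density \<mu> \<sigma> x * (x - \<mu>) ^ 4) (3 * \<sigma> ^ 4)"
    using normal_moment_even[OF \<sigma>, of \<mu> 2]
    by (simp add: fact_numeral power_divide field_simps flip: power_mult)
  have "(\<integral>\<^sup>+\<omega>. ennreal ((X \<omega> - \<mu>) ^ 4) \<partial>M)
      = (\<integral>\<^sup>+x. ennreal (normal_density \<mu> \<sigma> x) * ennreal ((x - \<mu>) ^ 4) \<partial>lborel)"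
    by (rule distributed_nn_integral[OF X, symmetric]) measurable
  also have "\<dots> = (\<integral>\<^sup>+x. ennreal (normal_density \<mu> \<sigma> x * (x - \<mu>) ^ 4) \<partial>lborel)"
    by (simp add: ennreal_mult')
  also have "\<dots> = ennreal (3 * \<sigma> ^ 4)"
    using m by (subst nn_integral_eq_integral) (auto simp: has_bochner_integral_iff)
  finally show ?thesis .
qed

text \<open>Plays the part of Markov's inequality with Borel-Cantelli. Sum and integral commute for
  nonnegative terms, so the series of the \<open>f n\<close> has finite integral and is therefore
  finite almost everywhere.\<close>

lemma AE_tendsto_zero_of_summable_nn_integral:
  fixes f :: "nat \<Rightarrow> 'a \<Rightarrow> real"
  assumes [measurable]: "\<And>n. f n \<in> borel_measurable M"
    and nonneg: "\<And>n \<omega>. 0 \<le> f n \<omega>"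
    and integral: "\<And>n. (\<integral>\<^sup>+\<omega>. ennreal (f n \<omega>) \<partial>M) = ennreal (c n)"
    and c: "\<And>n. 0 \<le> c n" "summable c"
  shows "AE \<omega> in M. (\<lambda>n. f n \<omega>) \<longlonglongrightarrow> 0"
proof -
  have "(\<integral>\<^sup>+\<omega>. (\<Sum>n. ennreal (f n \<omega>)) \<partial>M) = (\<Sum>n. ennreal (c n))"
    by (subst nn_integral_suminf) (auto simp: integral)
  also have "\<dots> \<noteq> \<infinity>"
    using c by (simp add: suminf_ennreal2)
  finally have "AE \<omega> in M. (\<Sum>n. ennreal (f n \<omega>)) \<noteq> \<infinity>"
    by (intro nn_integral_PInf_AE) auto
  then show ?thesis
  proof eventually_elim
    case (elim \<omega>)
    then have "summable (\<lambda>n. f n \<omega>)"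
      by (intro summable_suminf_not_top) (auto simp: nonneg)
    then show ?case
      by (rule summable_LIMSEQ_zero)
  qed
qed

text \<open>Second moments would not suffice: the variance of the mean of n samples is
  \<open>\<sigma>\<^sup>2 / n\<close>, which is not summable, whereas the fourth centred moment is
  \<open>3 * \<sigma> ^ 4 / n ^ 2\<close>.\<close>

lemma (in prob_space) normal_strong_law:
  fixes X :: "nat \<Rightarrow> 'a \<Rightarrow> real"
  assumes indep: "indep_vars (\<lambda>_. borel) X UNIV"
    and normal: "\<And>k. distributed M lborel (X k) (normal_density \<mu> \<sigma>)"
    and \<sigma>: "0 < \<sigma>"
  shows "AE \<omega> in M. (\<lambda>n. (\<Sum>k<n. X k \<omega>) / real n) \<longlonglongrightarrow> \<mu>"
proof -
  have [measurable]: "X k \<in> borel_measurable M" for k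
    using distributed_measurable[OF normal[of k]] by simp
  \<comment> \<open>The shift to \<open>Suc n\<close> avoids division by zero and keeps the index
    set nonempty, as \<open>sum_indep_normal\<close> requires.\<close>
  define f where "f n \<omega> = ((\<Sum>k<Suc n. X k \<omega>) / real (Suc n) - \<mu>) ^ 4" for n \<omega>
  have "(\<integral>\<^sup>+\<omega>. ennreal (f n \<omega>) \<partial>M) = ennreal (3 * \<sigma> ^ 4 * inverse (real (Suc n) ^ 2))" for n
  proof -
    have sum: "distributed M lborel (\<lambda>\<omega>. \<Sum>k<Suc n. X k \<omega>)
        (normal_density (\<Sum>k<Suc n. \<mu>) (sqrt (\<Sum>k<Suc n. \<sigma>\<^sup>2)))"
      using \<sigma> by (intro sum_indep_normal normal indep_vars_subset[OF indep]) auto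
    have "0 < sqrt (\<Sum>k<Suc n. \<sigma>\<^sup>2)"
      using \<sigma> by (simp del: sum.lessThan_Suc of_nat_Suc)
    from nn_integral_normal_fourth_moment[OF sum this]
    have fourth: "(\<integral>\<^sup>+\<omega>. ennreal (((\<Sum>k<Suc n. X k \<omega>) - real (Suc n) * \<mu>) ^ 4) \<partial>M)
        = ennreal (3 * sqrt (real (Suc n) * \<sigma>\<^sup>2) ^ 4)"
      by (simp only: sum_constant card_lessThan)
    have sqrt4: "sqrt (real (Suc n) * \<sigma>\<^sup>2) ^ 4 = real (Suc n) ^ 2 * \<sigma> ^ 4"
      using \<sigma> by (simp add: real_sqrt_mult power_mult_distrib power4_eq_xxxx power2_eq_square)
    have f: "f n \<omega> = inverse (real (Suc n) ^ 4) * ((\<Sum>k<Suc n. X k \<omega>) - real (Suc n) * \<mu>) ^ 4" for \<omega>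
    proof -
      have centre: "(\<Sum>k<Suc n. X k \<omega>) / real (Suc n) - \<mu>
          = ((\<Sum>k<Suc n. X k \<omega>) - real (Suc n) * \<mu>) / real (Suc n)"
        by (simp add: diff_divide_distrib del: sum.lessThan_Suc of_nat_Suc)
      show ?thesis
        unfolding f_def centre power_divide by (simp only: divide_inverse mult.commute)
    qed
    have "(\<integral>\<^sup>+\<omega>. ennreal (f n \<omega>) \<partial>M)
        = ennreal (inverse (real (Suc n) ^ 4)) * ennreal (3 * (real (Suc n) ^ 2 * \<sigma> ^ 4))"
      unfolding f by (simp add: ennreal_mult' nn_integral_cmult fourth sqrt4 del: sum.lessThan_Suc of_nat_Suc)
    also have "\<dots> = ennreal (inverse (real (Suc n) ^ 4) * (3 * (real (Suc n) ^ 2 * \<sigma> ^ 4)))"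
      by (rule ennreal_mult'[symmetric]) auto
    also have "inverse (real (Suc n) ^ 4) * (3 * (real (Suc n) ^ 2 * \<sigma> ^ 4))
        = 3 * \<sigma> ^ 4 * inverse (real (Suc n) ^ 2)"
      by (simp add: field_simps power4_eq_xxxx power2_eq_square del: of_nat_Suc)
    finally show ?thesis .
  qed
  moreover have "summable (\<lambda>n. 3 * \<sigma> ^ 4 * inverse (real (Suc n) ^ 2))"
    using inverse_power_summable[of 2, where 'a=real]
    by (intro summable_mult) (simp add: summable_Suc_iff[of "\<lambda>n. inverse (real n ^ 2)"] del: of_nat_Suc)
  ultimately have "AE \<omega> in M. (\<lambda>n. f n \<omega>) \<longlonglongrightarrow> 0"
    by (intro AE_tendsto_zero_of_summable_nn_integral) (auto simp: f_def)
  then show ?thesis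
  proof eventually_elim
    case (elim \<omega>)
    define d where "d n = (\<Sum>k<n. X k \<omega>) / real n - \<mu>" for n
    \<comment> \<open>Continuity of the fourth root undoes the fourth power, up to an absolute
      value.\<close>
    have "(\<lambda>n. root 4 (d (Suc n) ^ 4)) \<longlonglongrightarrow> root 4 0"
      using elim by (intro tendsto_real_root) (simp add: f_def d_def)
    moreover have "root 4 (x ^ 4) = \<bar>x\<bar>" for x
      using real_root_power_cancel[of 4 "\<bar>x\<bar>"] by simp
    ultimately have "(\<lambda>n. \<bar>d (Suc n)\<bar>) \<longlonglongrightarrow> 0"
      by simp
    then have "(\<lambda>n. d (Suc n)) \<longlonglongrightarrow> 0"
      by (simp add: tendsto_rabs_zero_iff)
    then have "d \<longlonglongrightarrow> 0"
      by (rule LIMSEQ_imp_Suc)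
    then show ?case
      unfolding d_def by (rule LIM_zero_cancel)
  qed
qed

text \<open>Independence means that the joint law is the product of the marginals. Here the joint
  law is the law of the identity, namely \<open>PiM I M\<close> itself, and its marginals are the
  \<open>M i\<close>.\<close>

lemma indep_vars_PiM_component:
  assumes "\<And>i. i \<in> I \<Longrightarrow> prob_space (M i)" "I \<noteq> {}"
  shows "prob_space.indep_vars (PiM I M) M (\<lambda>i \<omega>. \<omega> i) I"
proof -
  interpret prob_space "PiM I M"
    by (rule prob_space_PiM) (rule assms)
  \<comment> \<open>Points of \<open>PiM I M\<close> are extensional on \<open>I\<close>, so
    restricting them to \<open>I\<close> changes nothing.\<close>
  have "distr (PiM I M) (PiM I M) (\<lambda>x. \<lambda>i\<in>I. x i) = distr (PiM I M) (PiM I M) (\<lambda>x. x)"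
    by (rule distr_cong) (auto simp: space_PiM)
  also have "\<dots> = PiM I (\<lambda>i. distr (PiM I M) (M i) (\<lambda>\<omega>. \<omega> i))"
    using assms by (simp add: distr_PiM_component cong: PiM_cong)
  finally show ?thesis
    using assms by (subst indep_vars_iff_distr_eq_PiM') auto
qed

text \<open>The coordinates are an i.i.d. Gaussian sample, and for positive \<open>n\<close> the
  estimator is the affine map \<open>(m - x0) / t\<close> of the sample mean \<open>m\<close>. This
  map sends the limit \<open>x0 + \<mu> * t\<close> to \<open>\<mu>\<close>.\<close>

lemma AE_drift_estimator_tendsto:
  assumes "t > 0" "\<sigma> > 0"
  shows "AE z in infinite_power (drift_gaussian t x0 \<sigma> \<mu>).
           (\<lambda>n. drift_estimator t x0 n z) \<longlonglongrightarrow> \<mu>"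
proof -
  let ?\<gamma> = "drift_gaussian t x0 \<sigma> \<mu>"
  have pos: "0 < sqrt (\<sigma>\<^sup>2 * t)"
    using assms by simp
  have \<gamma>: "prob_space ?\<gamma>"
    unfolding drift_gaussian_def using pos by (rule prob_space_normal_density)
  have sets [measurable_cong]: "sets ?\<gamma> = sets borel"
    by (simp add: drift_gaussian_def)
  interpret prob_space "infinite_power ?\<gamma>"
    unfolding infinite_power_def by (rule prob_space_PiM) (rule \<gamma>)
  have "indep_vars (\<lambda>_. ?\<gamma>) (\<lambda>k z. z k) UNIV"
    unfolding infinite_power_def by (rule indep_vars_PiM_component) (auto intro: \<gamma>)
  then have indep: "indep_vars (\<lambda>_. borel) (\<lambda>k z. z k) UNIV"
    by (rule indep_vars_compose2[where Y="\<lambda>_ x. x"]) measurable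
  have comp: "distr (infinite_power ?\<gamma>) ?\<gamma> (\<lambda>z. z k) = ?\<gamma>" for k
    unfolding infinite_power_def by (rule distr_PiM_component) (auto intro: \<gamma>)
  have [measurable]: "(\<lambda>z. z k) \<in> borel_measurable (infinite_power ?\<gamma>)" for k
    unfolding infinite_power_def by measurable
  \<comment> \<open>\<open>distr\<close> depends on its target measure only through the measurable
    sets, so \<open>lborel\<close> may replace the Gaussian measure as target.\<close>
  have "distr (infinite_power ?\<gamma>) lborel (\<lambda>z. z k) = ?\<gamma>" for k
    by (subst (2) comp[of k, symmetric]) (rule distr_cong, simp_all add: sets)
  then have normal: "distributed (infinite_power ?\<gamma>) lborel (\<lambda>z. z k)
      (normal_density (x0 + \<mu> * t) (sqrt (\<sigma>\<^sup>2 * t)))" for k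
    unfolding distributed_def drift_gaussian_def[of t x0 \<sigma> \<mu>, symmetric] by simp
  show ?thesis
    using normal_strong_law[OF indep normal pos]
  proof eventually_elim
    case (elim z)
    then have "(\<lambda>n. ((\<Sum>k<n. z k) / real n - x0) / t) \<longlonglongrightarrow> (x0 + \<mu> * t - x0) / t"
      using assms by (intro tendsto_intros) auto
    \<comment> \<open>At \<open>n = 0\<close> division by zero yields \<open>- x0 / t\<close> on the
      left but 0 on the right, hence only an eventual equality.\<close>
    moreover have "\<forall>\<^sub>F n in sequentially.
        ((\<Sum>k<n. z k) / real n - x0) / t = drift_estimator t x0 n z"
      using eventually_gt_at_top[of 0]
      by eventually_elim (use assms in \<open>simp add: drift_estimator_def sum_subtractf diff_divide_distrib\<close>)
    ultimately show ?case
      using assms by (simp add: tendsto_cong)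
  qed
qed

lemma borel_measurable_real_value [measurable]: "real_value lo hi \<in> borel_measurable borel"
  unfolding real_value_def[abs_def] by measurable

text \<open>Treats both estimators at once: the sequences along which the estimates fail to converge
  to \<open>\<mu>\<close> form a null set, so the values of \<open>T\<close> there are
  immaterial.\<close>

lemma infinite_sample_consistent_drift:
  assumes "t > 0" "\<sigma> > 0" and meas: "T \<in> borel_measurable borel"
    and T: "\<And>z \<mu>. (\<lambda>n. drift_estimator t x0 n z) \<longlonglongrightarrow> \<mu> \<Longrightarrow> T z = \<mu>"
  shows "infinite_sample_consistent (drift_gaussian t x0 \<sigma>) T"
  unfolding infinite_sample_consistent_def
proof (intro conjI allI meas)
  fix \<mu>
  let ?\<gamma> = "drift_gaussian t x0 \<sigma> \<mu>"
  show \<gamma>: "prob_space ?\<gamma>"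
    unfolding drift_gaussian_def using assms by (intro prob_space_normal_density) simp
  show "sets ?\<gamma> = sets borel"
    by (simp add: drift_gaussian_def)
  then have sets: "sets (infinite_power ?\<gamma>) = sets borel"
    unfolding infinite_power_def by (simp add: sets_PiM_equal_borel cong: sets_PiM_cong)
  interpret prob_space "infinite_power ?\<gamma>"
    unfolding infinite_power_def by (rule prob_space_PiM) (rule \<gamma>)
  \<comment> \<open>\<open>emeasure\<close> is 0 by default on nonmeasurable sets, so measurability
    must precede the passage from the almost sure statement to measure 1.\<close>
  have "{z. T z = \<mu>} \<in> sets (infinite_power ?\<gamma>)"
    unfolding sets using measurable_sets[OF meas, of "{\<mu>}"] by (simp add: vimage_def)
  moreover have "AE z in infinite_power ?\<gamma>. T z = \<mu>"
    using AE_drift_estimator_tendsto[OF assms(1,2)] by eventually_elim (rule T)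
  ultimately show "emeasure (infinite_power ?\<gamma>) {z. T z = \<mu>} = 1"
    using emeasure_eq_1_AE by auto
qed

theorem theorem3p2p2:
  fixes t x0 \<sigma> lo hi :: real
  assumes "t > 0" and "\<sigma> > 0"
  shows "infinite_sample_consistent (drift_gaussian t x0 \<sigma>) (liminf_estimator lo hi t x0)
       \<and> infinite_sample_consistent (drift_gaussian t x0 \<sigma>) (limsup_estimator lo hi t x0)"
proof -
  have [measurable]: "drift_estimator t x0 n \<in> borel_measurable borel" for n
    unfolding drift_estimator_def[abs_def] by measurable
  have "liminf_estimator lo hi t x0 \<in> borel_measurable borel"
    "limsup_estimator lo hi t x0 \<in> borel_measurable borel"
    unfolding liminf_estimator_def[abs_def] limsup_estimator_def[abs_def] by measurable
  moreover have "liminf_estimator lo hi t x0 z = \<mu>" "limsup_estimator lo hi t x0 z = \<mu>"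
    if "(\<lambda>n. drift_estimator t x0 n z) \<longlonglongrightarrow> \<mu>" for z \<mu>
  proof -
    \<comment> \<open>The limit is a real number, so the lower and upper limits are finite and
      \<open>real_value\<close> never falls back on \<open>lo\<close> or \<open>hi\<close>.\<close>
    have lim: "(\<lambda>n. ereal (drift_estimator t x0 n z)) \<longlonglongrightarrow> ereal \<mu>"
      using that by simp
    show "liminf_estimator lo hi t x0 z = \<mu>" "limsup_estimator lo hi t x0 z = \<mu>"
      using lim_imp_Liminf[OF _ lim] lim_imp_Limsup[OF _ lim]
      by (simp_all add: liminf_estimator_def limsup_estimator_def real_value_def)
  qed
  ultimately show ?thesis
    using assms by (blast intro: infinite_sample_consistent_drift)
qed

end
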